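(* Let $\bigoplus^{\infty}\mathbb{Z}$ be the direct sum of countably infinitely many copies of $\mathbb{Z}$, with the $\ell_1$-metric. Then $2\text{-dim}\left(\bigoplus^{\infty}\mathbb{Z}\right)=\infty$.
   Context: Let $X$ be a metric space and $\lambda>0$. Two points $x,y$ of a set are $\lambda$-connected in it if there is a finite sequence of points of the set from $x$ to $y$ with consecutive distances at most $\lambda$; a set is a $\lambda$-cluster if every two of its points are $\lambda$-connected in it. For $\lambda,D>0$ we say $(\lambda,D)\text{-dim}(X)\le n$ if the points of $X$ can be colored in at most $n+1$ colors so that every monochromatic $\lambda$-cluster has diameter at most $D$; $(\lambda,D)\text{-dim}(X)$ is the smallest such $n$ ($\infty$ if there is none). Finally $\lambda\text{-dim}(X)=\inf\{(\lambda,D)\text{-dim}(X)\mid D>0\}$. *)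

theory Defs
  imports "HOL-Analysis.Abstract_Metric_Spaces" "HOL-Library.Poly_Mapping"
    "HOL-Library.Extended_Nat" "HOL-Library.Extended_Nonnegative_Real"
begin

context Metric_space
begin

definition scale_connected :: "real \<Rightarrow> 'a set \<Rightarrow> 'a \<Rightarrow> 'a \<Rightarrow> bool" where
  "scale_connected l S x y \<longleftrightarrow>
     (\<exists>xs. xs \<noteq> [] \<and> hd xs = x \<and> last xs = y \<and> set xs \<subseteq> S \<and>
           successively (\<lambda>u v. d u v \<le> l) xs)"

definition scale_cluster :: "real \<Rightarrow> 'a set \<Rightarrow> bool" where
  "scale_cluster l S \<longleftrightarrow> S \<subseteq> M \<and> (\<forall>x\<in>S. \<forall>y\<in>S. scale_connected l S x y)"

(* The library's diameter is tied to the type class metric_space and is real-valued;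
   here unbounded sets get diameter infinity and the empty set gets 0. *)
definition ediameter :: "'a set \<Rightarrow> ennreal" where
  "ediameter S = (SUP (x, y) \<in> S \<times> S. ennreal (d x y))"

(* (l, D)-dim <= n; the n + 1 available colours are 0, ..., n. *)
definition scale_bound_dim_le :: "real \<Rightarrow> real \<Rightarrow> nat \<Rightarrow> bool" where
  "scale_bound_dim_le l D n \<longleftrightarrow>
     (\<exists>c :: 'a \<Rightarrow> nat. c ` M \<subseteq> {..n} \<and>
        (\<forall>S. scale_cluster l S \<and> (\<exists>k. \<forall>x\<in>S. c x = k) \<longrightarrow> ediameter S \<le> ennreal D))"

(* On enat, the infimum of a nonempty set is its least element, and Inf {} = \<infinity>. *)
definition scale_bound_dim :: "real \<Rightarrow> real \<Rightarrow> enat" where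
  "scale_bound_dim l D = Inf {enat n | n. scale_bound_dim_le l D n}"

definition scale_dim :: "real \<Rightarrow> enat" where
  "scale_dim l = Inf {scale_bound_dim l D | D. D > 0}"

end

(* The type nat \<Rightarrow>\<^sub>0 int of finitely supported functions is the direct sum of
   countably infinitely many copies of the integers. *)
definition l1_dist :: "(nat \<Rightarrow>\<^sub>0 int) \<Rightarrow> (nat \<Rightarrow>\<^sub>0 int) \<Rightarrow> real" where
  "l1_dist f g = (\<Sum>i\<in>Poly_Mapping.keys (f - g). \<bar>real_of_int (Poly_Mapping.lookup f i - Poly_Mapping.lookup g i)\<bar>)"

lemma l1_dist_eq_sum:
  assumes "finite A" "Poly_Mapping.keys (f - g) \<subseteq> A"
  shows "l1_dist f g = (\<Sum>i\<in>A. \<bar>real_of_int (Poly_Mapping.lookup f i - Poly_Mapping.lookup g i)\<bar>)"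
  unfolding l1_dist_def
  by (rule sum.mono_neutral_left) (use assms in \<open>auto simp: in_keys_iff lookup_minus\<close>)

interpretation l1: Metric_space "UNIV :: (nat \<Rightarrow>\<^sub>0 int) set" l1_dist
proof
  fix f g h :: "nat \<Rightarrow>\<^sub>0 int"
  show "0 \<le> l1_dist f g"
    by (simp add: l1_dist_def sum_nonneg)
  show "l1_dist f g = l1_dist g f"
  proof -
    have "Poly_Mapping.keys (f - g) = Poly_Mapping.keys (g - f)"
      by (auto simp: in_keys_iff lookup_minus)
    then show ?thesis
      by (simp add: l1_dist_def abs_minus_commute)
  qed
  show "l1_dist f g = 0 \<longleftrightarrow> f = g"
  proof
    assume "l1_dist f g = 0"
    then have "Poly_Mapping.lookup f i = Poly_Mapping.lookup g i" for i
      by (cases "i \<in> Poly_Mapping.keys (f - g)")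
        (auto simp: l1_dist_def sum_nonneg_eq_0_iff in_keys_iff lookup_minus)
    then show "f = g"
      by (simp add: poly_mapping_eqI)
  qed (simp add: l1_dist_def)
  let ?A = "Poly_Mapping.keys (f - g) \<union> Poly_Mapping.keys (g - h) \<union> Poly_Mapping.keys (f - h)"
  have "l1_dist f h = (\<Sum>i\<in>?A. \<bar>real_of_int (Poly_Mapping.lookup f i - Poly_Mapping.lookup h i)\<bar>)"
    by (rule l1_dist_eq_sum) auto
  also have "\<dots> \<le> (\<Sum>i\<in>?A. \<bar>real_of_int (Poly_Mapping.lookup f i - Poly_Mapping.lookup g i)\<bar>
                        + \<bar>real_of_int (Poly_Mapping.lookup g i - Poly_Mapping.lookup h i)\<bar>)"
    by (rule sum_mono) linarith
  also have "\<dots> = (\<Sum>i\<in>?A. \<bar>real_of_int (Poly_Mapping.lookup f i - Poly_Mapping.lookup g i)\<bar>)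
                        + (\<Sum>i\<in>?A. \<bar>real_of_int (Poly_Mapping.lookup g i - Poly_Mapping.lookup h i)\<bar>)"
    by (rule sum.distrib)
  also have "\<dots> = l1_dist f g + l1_dist g h"
    by (intro arg_cong2[where f = "(+)"] l1_dist_eq_sum[symmetric]) auto
  finally show "l1_dist f h \<le> l1_dist f g + l1_dist g h" .
qed

end

theory Submission
  imports Defs "HOL-Library.Ramsey"
begin

text \<open>
  Colour the indicator vectors of the \<open>k\<close>-element subsets of the natural numbers. By Ramsey's
  theorem some infinite \<open>Y\<close> has all its \<open>k\<close>-element subsets of one colour. Exchanging one
  element at a time moves by distance 2, so these vectors form a monochromatic 2-cluster, and
  two disjoint \<open>k\<close>-element subsets of \<open>Y\<close> are at distance \<open>2 * k\<close>. Since \<open>k\<close> is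
  arbitrary, no finite number of colours bounds the diameters.
\<close>

definition indicator_vec :: "nat set \<Rightarrow> nat \<Rightarrow>\<^sub>0 int" where
  "indicator_vec A = (\<Sum>i\<in>A. Poly_Mapping.single i 1)"

lemma lookup_indicator_vec:
  assumes "finite A"
  shows "Poly_Mapping.lookup (indicator_vec A) i = of_bool (i \<in> A)"
  using assms by (simp add: indicator_vec_def lookup_sum lookup_single when_def)

text \<open>The vectors differ by exactly 1 on the symmetric difference and agree elsewhere. Hence
  one exchange moves by 1 + 1, while disjoint \<open>k\<close>-element sets are \<open>k + k\<close>
  apart.\<close>

lemma l1_dist_indicator_vec:
  assumes "finite A" "finite B"
  shows "l1_dist (indicator_vec A) (indicator_vec B) = card (A - B) + card (B - A)"
proof -
  have "l1_dist (indicator_vec A) (indicator_vec B) =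
      (\<Sum>i\<in>(A - B) \<union> (B - A). \<bar>real_of_int (of_bool (i \<in> A) - of_bool (i \<in> B))\<bar>)"
    using assms
    by (subst l1_dist_eq_sum[where A = "(A - B) \<union> (B - A)"])
      (auto simp: lookup_indicator_vec in_keys_iff lookup_minus split: if_splits)
  also have "\<dots> = (\<Sum>i\<in>(A - B) \<union> (B - A). 1)"
    by (rule sum.cong) auto
  also have "\<dots> = card (A - B) + card (B - A)"
    using assms by (simp add: card_Un_disjoint Diff_Int_distrib2 Int_Diff disjnt_def)
  finally show ?thesis .
qed

text \<open>Induction on the number of elements of \<open>A\<close> still to be exchanged. Only
  elements of \<open>B\<close> are brought in, so every intermediate set stays inside
  \<open>Y\<close>; this keeps the chain monochromatic once \<open>Y\<close> comes from Ramsey's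
  theorem.\<close>

lemma scale_connected_indicator_vec:
  assumes "A \<in> nsets Y k" "B \<in> nsets Y k"
  shows "l1.scale_connected 2 (indicator_vec ` nsets Y k) (indicator_vec A) (indicator_vec B)"
  using assms
proof (induction "card (A - B)" arbitrary: A rule: less_induct)
  case less
  then have fin: "finite A" "finite B" and sub: "A \<subseteq> Y" "B \<subseteq> Y"
    and card: "card A = k" "card B = k"
    by (auto simp: nsets_def)
  show ?case
  proof (cases "A = B")
    case True
    then show ?thesis
      using less.prems
      by (auto simp: l1.scale_connected_def intro!: exI[of _ "[indicator_vec B]"])
  next
    case False
    \<comment> \<open>Distinct finite sets of equal size cannot contain one another, so each side
      offers an element to exchange.\<close>
    obtain a where a: "a \<in> A" "a \<notin> B"
      using False fin card by (metis card_subset_eq subsetI)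
    obtain b where b: "b \<in> B" "b \<notin> A"
      using False fin card by (metis card_subset_eq subsetI)
    define A' where "A' = insert b (A - {a})"
    have "card A' = k"
      unfolding A'_def using a b fin card by (metis card_Suc_Diff1 card_insert_disjoint
          DiffD1 finite_Diff)
    then have A': "A' \<in> nsets Y k"
      using fin sub b by (auto simp: A'_def nsets_def)
    have "A' - B = (A - B) - {a}"
      using b by (auto simp: A'_def)
    then have "card (A' - B) < card (A - B)"
      using a fin by (metis card_Diff1_less DiffI finite_Diff)
    then obtain xs where xs: "xs \<noteq> []" "hd xs = indicator_vec A'" "last xs = indicator_vec B"
      "set xs \<subseteq> indicator_vec ` nsets Y k" "successively (\<lambda>u v. l1_dist u v \<le> 2) xs"
      using less.hyps A' less.prems unfolding l1.scale_connected_def by metis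
    have "A - A' = {a}" "A' - A = {b}"
      using a b by (auto simp: A'_def)
    then have "l1_dist (indicator_vec A) (indicator_vec A') = 2"
      using fin by (subst l1_dist_indicator_vec) (auto simp: A'_def)
    then show ?thesis
      unfolding l1.scale_connected_def using xs less.prems
      by (intro exI[of _ "indicator_vec A # xs"]) (auto simp: successively_Cons)
  qed
qed

lemma not_scale_bound_dim_le_two: "\<not> l1.scale_bound_dim_le 2 D n"
proof
  assume "l1.scale_bound_dim_le 2 D n"
  then obtain c where c: "range c \<subseteq> {..n}"
    and bound: "\<And>S. \<lbrakk>l1.scale_cluster 2 S; \<exists>k. \<forall>x\<in>S. c x = k\<rbrakk> \<Longrightarrow> l1.ediameter S \<le> ennreal D"
    unfolding l1.scale_bound_dim_le_def by auto
  \<comment> \<open>This gives \<open>D < k\<close>, and the successor keeps \<open>k\<close>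
    positive even if \<open>D\<close> \<le> 0.\<close>
  define k where "k = Suc (nat \<lceil>D\<rceil>)"
  have "(c \<circ> indicator_vec) ` nsets UNIV k \<subseteq> {..<Suc n}"
    using c by (force simp: less_Suc_eq_le)
  then obtain Y t where Y: "infinite Y" "(c \<circ> indicator_vec) ` nsets Y k \<subseteq> {t}"
    using Ramsey_nsets[OF infinite_UNIV_nat] by metis
  define S where "S = indicator_vec ` nsets Y k"
  have "l1.scale_cluster 2 S"
    unfolding S_def l1.scale_cluster_def by (auto intro: scale_connected_indicator_vec)
  moreover have "\<forall>x\<in>S. c x = t"
    using Y by (auto simp: S_def)
  ultimately have le: "l1.ediameter S \<le> ennreal D"
    using bound by blast
  obtain A where A: "finite A" "card A = k" "A \<subseteq> Y"
    using infinite_arbitrarily_large[OF Y(1)] by blast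
  obtain B where B: "finite B" "card B = k" "B \<subseteq> Y - A"
    using infinite_arbitrarily_large[of "Y - A" k] Y(1) A(1) by auto
  have "A - B = A" "B - A = B"
    using B by auto
  then have "l1_dist (indicator_vec A) (indicator_vec B) = 2 * real k"
    using A B by (simp add: l1_dist_indicator_vec)
  moreover have "indicator_vec A \<in> S" "indicator_vec B \<in> S"
    using A B by (auto simp: S_def nsets_def)
  ultimately have "ennreal (2 * real k) \<le> l1.ediameter S"
    unfolding l1.ediameter_def
    by (intro SUP_upper2[of "(indicator_vec A, indicator_vec B)"]) auto
  also note le
  finally have "ennreal (2 * real k) \<le> ennreal D" .
  moreover have "D < 2 * real k"
    using real_nat_ceiling_ge[of D] by (simp add: k_def)
  \<comment> \<open>\<open>ennreal\<close> sends negative reals to 0; positivity of the left side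
    excludes the case where both sides collapse to 0.\<close>
  moreover have "0 < real k"
    by (simp add: k_def)
  ultimately show False
    by (simp add: ennreal_le_iff2)
qed

theorem theorem3p8:
  shows "Metric_space.scale_dim (UNIV :: (nat \<Rightarrow>\<^sub>0 int) set) l1_dist 2 = \<infinity>"
proof -
  \<comment> \<open>No \<open>n\<close> qualifies, so this is the infimum of the empty set; the
    outer infimum then ranges over \<infinity> alone.\<close>
  have "l1.scale_bound_dim 2 D = \<infinity>" for D
    by (simp add: l1.scale_bound_dim_def not_scale_bound_dim_le_two Inf_enat_def)
  then show ?thesis
    by (auto simp: l1.scale_dim_def top_enat_def[symmetric] Inf_top_conv)
qed

end
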